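(* (i) The class (I, I) of generalized triplets consists of the triplets of odd primes $$p_i=2a-D_1,\quad p_m=2a+D_1=2b-D_2,\quad p_f=2b+D_2$$ with $D_1,D_2$ odd positive integers and $a,b$ integers subject to $b-a=(D_1+D_2)/2$. Hence $p_f=2a+D_1+2D_2$, and the prime pair consisting of $p_f=2a+D_2+(D_1+D_2)$ and $p_i=2a+D_2-(D_1+D_2)$ is in class II, or special, or in class III. (ii) If moreover $D_1\equiv 2r_1+1\pmod 6$, $D_2\equiv 2r_2+1\pmod 6$ with $r_1,r_2\in\{0,1,-1\}$ and $a\equiv a_0\pmod 3$ with $a_0\in\{0,1,-1\}$, then $$p_i\equiv -2r_1-1+2a_0,\quad p_m\equiv 2r_1+1+2a_0,\quad p_f\equiv 2a_0+3+2r_1+4r_2,\quad D_1+D_2\equiv 2(r_1+r_2)+2\pmod 6.$$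
   Context: A generalized triplet is a triple of odd primes $p_i<p_m<p_f$ with $p_m-p_i=2D_1$, $p_f-p_m=2D_2$. For a pair of odd primes $p<p'$ with $p'-p=2D$, the classes are, with $a$ an integer: class I: $D$ odd, $p=2a-D$, $p'=2a+D$; class II: $2\mid D$, $3\nmid D$, $p=3(2a-1)-D$, $p'=3(2a-1)+D$; class III: $6\mid D$, $D\ge 6$, $p=2a+1-D$, $p'=2a+1+D$. A pair is special if $p=3$, $2\mid D$ and $3\nmid D$. A triplet is in class $(X,Y)$ if $(p_i,p_m)$ is in class $X$ and $(p_m,p_f)$ is in class $Y$. *)

theory Defs
  imports "HOL-Number_Theory.Number_Theory"
begin

text \<open>
  Primes are taken in \<^typ>\<open>int\<close>, where \<^const>\<open>prime\<close> entails positivity, so that all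
  subtractions are exact. The half-gap \<open>D\<close> is determined by \<open>p\<close> and \<open>p'\<close>.
\<close>

definition odd_prime_pair :: "int \<Rightarrow> int \<Rightarrow> int \<Rightarrow> bool" where
  "odd_prime_pair p p' D \<longleftrightarrow>
     prime p \<and> odd p \<and> prime p' \<and> odd p' \<and> p < p' \<and> p' - p = 2 * D"

definition class_I :: "(int \<times> int) set" where
  "class_I = {(p, p'). \<exists>D a. odd_prime_pair p p' D \<and> odd D \<and>
                 p = 2 * a - D \<and> p' = 2 * a + D}"

definition class_II :: "(int \<times> int) set" where
  "class_II = {(p, p'). \<exists>D a. odd_prime_pair p p' D \<and> 2 dvd D \<and> \<not> 3 dvd D \<and>
                 p = 3 * (2 * a - 1) - D \<and> p' = 3 * (2 * a - 1) + D}"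

definition class_III :: "(int \<times> int) set" where
  "class_III = {(p, p'). \<exists>D a. odd_prime_pair p p' D \<and> 6 dvd D \<and> D \<ge> 6 \<and>
                 p = 2 * a + 1 - D \<and> p' = 2 * a + 1 + D}"

definition special_pairs :: "(int \<times> int) set" where
  "special_pairs = {(p, p'). \<exists>D. odd_prime_pair p p' D \<and> p = 3 \<and> 2 dvd D \<and> \<not> 3 dvd D}"

definition generalized_triplets :: "(int \<times> int \<times> int) set" where
  "generalized_triplets = {(p\<^sub>i, p\<^sub>m, p\<^sub>f).
     \<exists>D\<^sub>1 D\<^sub>2. odd_prime_pair p\<^sub>i p\<^sub>m D\<^sub>1 \<and> odd_prime_pair p\<^sub>m p\<^sub>f D\<^sub>2}"

definition triplet_class ::
    "(int \<times> int) set \<Rightarrow> (int \<times> int) set \<Rightarrow> (int \<times> int \<times> int) set" where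
  "triplet_class X Y = {(p\<^sub>i, p\<^sub>m, p\<^sub>f).
     (p\<^sub>i, p\<^sub>m, p\<^sub>f) \<in> generalized_triplets \<and> (p\<^sub>i, p\<^sub>m) \<in> X \<and> (p\<^sub>m, p\<^sub>f) \<in> Y}"

text \<open>
  In the parametrization below \<open>D\<^sub>1 + D\<^sub>2\<close> is even, so the integer division by 2 is exact.
\<close>

definition I_I_param :: "int \<Rightarrow> int \<Rightarrow> int \<Rightarrow> int \<Rightarrow> int \<Rightarrow> int \<Rightarrow> int \<Rightarrow> bool" where
  "I_I_param p\<^sub>i p\<^sub>m p\<^sub>f D\<^sub>1 D\<^sub>2 a b \<longleftrightarrow>
     prime p\<^sub>i \<and> odd p\<^sub>i \<and> prime p\<^sub>m \<and> odd p\<^sub>m \<and> prime p\<^sub>f \<and> odd p\<^sub>f \<and>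
     odd D\<^sub>1 \<and> D\<^sub>1 > 0 \<and> odd D\<^sub>2 \<and> D\<^sub>2 > 0 \<and>
     p\<^sub>i = 2 * a - D\<^sub>1 \<and> p\<^sub>m = 2 * a + D\<^sub>1 \<and> p\<^sub>m = 2 * b - D\<^sub>2 \<and> p\<^sub>f = 2 * b + D\<^sub>2 \<and>
     b - a = (D\<^sub>1 + D\<^sub>2) div 2"

end

theory Submission
  imports Defs
begin

text \<open>The outer pair of a class (I, I) triplet has half-gap
  \<open>D\<^sub>1 + D\<^sub>2\<close>, a sum of two odd numbers and so even. Every odd prime pair
  with even half-gap \<open>D\<close> falls under one of the three headings: if 3 divides
  \<open>D\<close>, then so does 6, and the odd midpoint \<open>p + D\<close> gives class III.
  Otherwise \<open>p\<close>, \<open>p + D\<close>, \<open>p + 2 * D\<close> are distinct modulo 3,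
  so exactly one is a multiple of 3. For the primes at the ends this means \<open>p = 3\<close>, the
  special case; else the odd midpoint is an odd multiple of 3, which is class II. This is
  \<open>odd_prime_pair_even_gap_cases\<close>. The parametrization
  (\<open>triplet_class_I_I_iff\<close>) and the residues (\<open>I_I_param_residues\<close>) are
  linear arithmetic.\<close>

lemma odd_prime_pair_even_gap_cases:
  assumes pair: "odd_prime_pair p p' D" and "2 dvd D"
  shows "(p, p') \<in> class_II \<or> (p, p') \<in> special_pairs \<or> (p, p') \<in> class_III"
proof (cases "3 dvd D")
  case True
  then have "6 dvd D"
    using assms by presburger
  moreover have "D \<ge> 6"
    using zdvd_imp_le[OF \<open>6 dvd D\<close>] pair unfolding odd_prime_pair_def by linarith
  moreover obtain k where "p + D = 2 * k + 1"
    using assms unfolding odd_prime_pair_def by (metis even_add oddE)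
  then have "p = 2 * k + 1 - D" "p' = 2 * k + 1 + D"
    using pair unfolding odd_prime_pair_def by linarith+
  ultimately show ?thesis
    using pair unfolding class_III_def by blast
next
  case False
  show ?thesis
  proof (cases "p = 3")
    case True
    then show ?thesis
      using assms False unfolding special_pairs_def by blast
  next
    case p_ne_3: False
    have "prime (3::int)"
      by simp
    \<comment> \<open>The only prime below 3 is 2, which is not odd, so 3 cannot be the larger
      member.\<close>
    moreover have "p' \<noteq> 3"
    proof
      assume "p' = 3"
      then have "p = 2"
        using pair prime_ge_2_int[of p] unfolding odd_prime_pair_def by linarith
      then show False
        using pair unfolding odd_prime_pair_def by simp
    qed
    ultimately have "\<not> 3 dvd p" "\<not> 3 dvd p'"
      using pair p_ne_3 primes_dvd_imp_eq unfolding odd_prime_pair_def by blast+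
    \<comment> \<open>The residues of \<open>p\<close> and \<open>p + 2 D\<close> modulo 3 are both nonzero, which forces \<open>p \<equiv> -D\<close>.\<close>
    moreover have "p' = p + 2 * D" "odd (p + D)"
      using assms unfolding odd_prime_pair_def by auto
    ultimately have "(p + D) mod 6 = 3"
      using False by presburger
    \<comment> \<open>With quotient q, 6 * q + 3 = 3 * (2 * (q + 1) - 1); the shift by one matches
      the form 2 * a - 1 of odd numbers in \<open>class_II\<close>.\<close>
    then have "p + D = 3 * (2 * ((p + D) div 6 + 1) - 1)"
      by presburger
    then obtain k where "p + D = 3 * (2 * k - 1)" ..
    then have "p = 3 * (2 * k - 1) - D" "p' = 3 * (2 * k - 1) + D"
      using pair unfolding odd_prime_pair_def by linarith+
    then show ?thesis
      using assms False unfolding class_II_def by blast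
  qed
qed

lemma I_I_param_outer_pair:
  assumes "I_I_param p\<^sub>i p\<^sub>m p\<^sub>f D\<^sub>1 D\<^sub>2 a b"
  shows "odd_prime_pair p\<^sub>i p\<^sub>f (D\<^sub>1 + D\<^sub>2)" "2 dvd D\<^sub>1 + D\<^sub>2"
  using assms unfolding I_I_param_def odd_prime_pair_def by auto

text \<open>Equating the two expressions for \<open>p\<^sub>m\<close> gives 2 * (b - a) =
  \<open>D\<^sub>1 + D\<^sub>2\<close>, so the relation between \<open>a\<close> and
  \<open>b\<close> is automatic; positivity of the half-gaps corresponds to the strict order of the
  primes.\<close>

lemma triplet_class_I_I_iff:
  "(p\<^sub>i, p\<^sub>m, p\<^sub>f) \<in> triplet_class class_I class_I \<longleftrightarrow>
     (\<exists>D\<^sub>1 D\<^sub>2 a b. I_I_param p\<^sub>i p\<^sub>m p\<^sub>f D\<^sub>1 D\<^sub>2 a b)" (is "?L \<longleftrightarrow> ?R")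
proof
  assume ?L
  then obtain D\<^sub>1 a D\<^sub>2 b where
    "odd_prime_pair p\<^sub>i p\<^sub>m D\<^sub>1" "odd D\<^sub>1" "p\<^sub>i = 2 * a - D\<^sub>1" "p\<^sub>m = 2 * a + D\<^sub>1"
    "odd_prime_pair p\<^sub>m p\<^sub>f D\<^sub>2" "odd D\<^sub>2" "p\<^sub>m = 2 * b - D\<^sub>2" "p\<^sub>f = 2 * b + D\<^sub>2"
    unfolding triplet_class_def class_I_def by blast
  then have "I_I_param p\<^sub>i p\<^sub>m p\<^sub>f D\<^sub>1 D\<^sub>2 a b"
    unfolding I_I_param_def odd_prime_pair_def by auto
  then show ?R by blast
next
  assume ?R
  then obtain D\<^sub>1 D\<^sub>2 a b where param: "I_I_param p\<^sub>i p\<^sub>m p\<^sub>f D\<^sub>1 D\<^sub>2 a b"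
    by blast
  then have "odd_prime_pair p\<^sub>i p\<^sub>m D\<^sub>1" "odd_prime_pair p\<^sub>m p\<^sub>f D\<^sub>2"
    unfolding I_I_param_def odd_prime_pair_def by auto
  with param show ?L
    unfolding triplet_class_def generalized_triplets_def class_I_def I_I_param_def by blast
qed

lemma I_I_param_p\<^sub>f:
  assumes "I_I_param p\<^sub>i p\<^sub>m p\<^sub>f D\<^sub>1 D\<^sub>2 a b"
  shows "p\<^sub>f = 2 * a + D\<^sub>1 + 2 * D\<^sub>2"
  using assms unfolding I_I_param_def by linarith

lemma I_I_param_residues:
  assumes param: "I_I_param p\<^sub>i p\<^sub>m p\<^sub>f D\<^sub>1 D\<^sub>2 a b"
    and D1: "[D\<^sub>1 = 2 * r\<^sub>1 + 1] (mod 6)" and D2: "[D\<^sub>2 = 2 * r\<^sub>2 + 1] (mod 6)"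
    and a: "[a = a\<^sub>0] (mod 3)"
  shows "[p\<^sub>i = - 2 * r\<^sub>1 - 1 + 2 * a\<^sub>0] (mod 6)"
    and "[p\<^sub>m = 2 * r\<^sub>1 + 1 + 2 * a\<^sub>0] (mod 6)"
    and "[p\<^sub>f = 2 * a\<^sub>0 + 3 + 2 * r\<^sub>1 + 4 * r\<^sub>2] (mod 6)"
    and "[D\<^sub>1 + D\<^sub>2 = 2 * (r\<^sub>1 + r\<^sub>2) + 2] (mod 6)"
proof -
  \<comment> \<open>Doubling lifts the congruence from modulus 3 to 6, which suffices because
    \<open>a\<close> enters the primes only as \<open>2 * a\<close>.\<close>
  have a2: "[2 * a = 2 * a\<^sub>0] (mod 6)"
    using a unfolding cong_iff_dvd_diff by presburger
  have p\<^sub>i: "p\<^sub>i = 2 * a - D\<^sub>1"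
    using param unfolding I_I_param_def by blast
  show "[p\<^sub>i = - 2 * r\<^sub>1 - 1 + 2 * a\<^sub>0] (mod 6)"
    unfolding p\<^sub>i using cong_diff[OF a2 D1] by (simp add: algebra_simps)
  show "[p\<^sub>m = 2 * r\<^sub>1 + 1 + 2 * a\<^sub>0] (mod 6)"
    using cong_add[OF D1 a2] param by (simp add: I_I_param_def algebra_simps)
  \<comment> \<open>The constant 3 is 1 from \<open>D\<^sub>1\<close> plus 2 from
    \<open>2 * D\<^sub>2\<close>.\<close>
  show "[p\<^sub>f = 2 * a\<^sub>0 + 3 + 2 * r\<^sub>1 + 4 * r\<^sub>2] (mod 6)"
    using cong_add[OF cong_add[OF a2 D1] cong_scalar_left[OF D2, of 2]] I_I_param_p\<^sub>f[OF param]
    by (simp add: algebra_simps)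
  show "[D\<^sub>1 + D\<^sub>2 = 2 * (r\<^sub>1 + r\<^sub>2) + 2] (mod 6)"
    using cong_add[OF D1 D2] by (simp add: algebra_simps)
qed

theorem corollary2p5:
  "triplet_class class_I class_I =
     {(p\<^sub>i, p\<^sub>m, p\<^sub>f). \<exists>D\<^sub>1 D\<^sub>2 a b. I_I_param p\<^sub>i p\<^sub>m p\<^sub>f D\<^sub>1 D\<^sub>2 a b} \<and>
   (\<forall>p\<^sub>i p\<^sub>m p\<^sub>f D\<^sub>1 D\<^sub>2 a b. I_I_param p\<^sub>i p\<^sub>m p\<^sub>f D\<^sub>1 D\<^sub>2 a b \<longrightarrow>
      p\<^sub>f = 2 * a + D\<^sub>1 + 2 * D\<^sub>2 \<and>
      p\<^sub>f = 2 * a + D\<^sub>2 + (D\<^sub>1 + D\<^sub>2) \<and>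
      p\<^sub>i = 2 * a + D\<^sub>2 - (D\<^sub>1 + D\<^sub>2) \<and>
      ((p\<^sub>i, p\<^sub>f) \<in> class_II \<or> (p\<^sub>i, p\<^sub>f) \<in> special_pairs \<or> (p\<^sub>i, p\<^sub>f) \<in> class_III)) \<and>
   (\<forall>p\<^sub>i p\<^sub>m p\<^sub>f D\<^sub>1 D\<^sub>2 a b r\<^sub>1 r\<^sub>2 a\<^sub>0.
      I_I_param p\<^sub>i p\<^sub>m p\<^sub>f D\<^sub>1 D\<^sub>2 a b \<longrightarrow>
      r\<^sub>1 \<in> {0, 1, -1} \<longrightarrow> r\<^sub>2 \<in> {0, 1, -1} \<longrightarrow> a\<^sub>0 \<in> {0, 1, -1} \<longrightarrow>
      [D\<^sub>1 = 2 * r\<^sub>1 + 1] (mod 6) \<longrightarrow> [D\<^sub>2 = 2 * r\<^sub>2 + 1] (mod 6) \<longrightarrow> [a = a\<^sub>0] (mod 3) \<longrightarrow>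
      [p\<^sub>i = - 2 * r\<^sub>1 - 1 + 2 * a\<^sub>0] (mod 6) \<and>
      [p\<^sub>m = 2 * r\<^sub>1 + 1 + 2 * a\<^sub>0] (mod 6) \<and>
      [p\<^sub>f = 2 * a\<^sub>0 + 3 + 2 * r\<^sub>1 + 4 * r\<^sub>2] (mod 6) \<and>
      [D\<^sub>1 + D\<^sub>2 = 2 * (r\<^sub>1 + r\<^sub>2) + 2] (mod 6))"
proof (intro conjI allI impI, goal_cases)
  case 1
  show ?case
    by (simp add: set_eq_iff triplet_class_I_I_iff)
next
  case (5 p\<^sub>i p\<^sub>m p\<^sub>f D\<^sub>1 D\<^sub>2 a b)
  then show ?case
    using odd_prime_pair_even_gap_cases[OF I_I_param_outer_pair] by blast
\<comment> \<open>What remains are the linear identities for \<open>p\<^sub>f\<close> and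
  \<open>p\<^sub>i\<close> and the four congruences.\<close>
qed ((simp add: I_I_param_p\<^sub>f; fail) | (simp add: I_I_param_def; fail) |
     (rule I_I_param_residues; assumption))+

end
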